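(* Let $G=(V,E)$ be an undirected graph with vertex set $V=\{v_1,\dots,v_n\}$ and edge set $E=\{e_{i_1j_1},\dots,e_{i_mj_m}\}$, where $e_{i_kj_k}$ joins $v_{i_k}$ and $v_{j_k}$. Each edge $e_{i_kj_k}$ carries a vector $C_{i_kj_k}\in\mathbb{R}^q$, and $\{p_\theta\}$ is a family of functions $\mathbb{R}^q\to(0,\infty)$ depending differentiably on a parameter vector $\theta\in\mathbb{R}^{n_\theta}$. For each $\theta$, let $G_\theta$ be the weighted graph on $(V,E)$ with edge weights $w_{i_kj_k}=p_\theta(C_{i_kj_k})$, and let $L_\theta$ be its Laplacian. Let $S\subseteq V$ and let $F\in\mathbb{R}^{|S|\times|S|}$ be a given matrix with zero diagonal, with entries $F_{lk}$ indexed by $v_l,v_k\in S$. Define $$\mathcal{L}(\theta)=\|R_S(\theta)-F\|_F^2=\sum_{v_l,v_k\in S}\big(R_S(\theta)_{lk}-F_{lk}\big)^2,$$ where $R_S(\theta)_{lk}=b_{lk}^TL_\theta^+b_{lk}$ is the effective resistance between $v_l$ and $v_k$ in $G_\theta$. Let $J\in\mathbb{R}^{m\times n_\theta}$ be the Jacobian $J_{k,h}=\frac{\partial w_{i_kj_k}}{\partial\theta_h}$, and let $B\in\mathbb{R}^{m\times n}$ be the edge–vertex incidence matrix whose $k$-th row is $e_{i_k}-e_{j_k}$ (standard basis vectors of $\mathbb{R}^n$). Then $$\nabla_\theta\mathcal{L}=\sum_{v_l,v_k\in S}\big(F_{lk}-b_{lk}^TL_\theta^+b_{lk}\big)\cdot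 2J^T\,(BL_\theta^+b_{lk})^{\circ 2},$$ where $^{\circ 2}$ denotes the entrywise square of a vector.
   Context: For a weighted undirected graph with weights $w_{ij}$ on edges $e_{ij}$, the degree matrix $D$ is diagonal with $D_{ii}=\sum_{j:e_{ij}\in E}w_{ij}$, the adjacency matrix $A$ has $A_{ij}=A_{ji}=w_{ij}$ for $e_{ij}\in E$ and $0$ otherwise, and the Laplacian is $L=D-A$. $L^+$ denotes the Moore–Penrose pseudoinverse. For nodes $v_i,v_j$, $b_{ij}\in\mathbb{R}^n$ is the vector with $1$ in position $i$, $-1$ in position $j$, and $0$ elsewhere; the effective resistance between $v_i$ and $v_j$ is $R_{ij}=b_{ij}^TL^+b_{ij}$. $\|\cdot\|_F$ is the Frobenius norm. *)

theory Defs
  imports "HOL-Analysis.Analysis"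
begin

text \<open>Weighted graph on vertex type 'n with edges indexed by the finite type 'm;
  edge k joins src k and tgt k and carries weight w k.\<close>

definition adjacency :: "('m::finite \<Rightarrow> 'n::finite) \<Rightarrow> ('m \<Rightarrow> 'n) \<Rightarrow> ('m \<Rightarrow> real) \<Rightarrow> real^'n^'n" where
  "adjacency src tgt w = (\<chi> i j. \<Sum>k\<in>{k. (src k = i \<and> tgt k = j) \<or> (src k = j \<and> tgt k = i)}. w k)"

definition degree_matrix :: "('m::finite \<Rightarrow> 'n::finite) \<Rightarrow> ('m \<Rightarrow> 'n) \<Rightarrow> ('m \<Rightarrow> real) \<Rightarrow> real^'n^'n" where
  "degree_matrix src tgt w = (\<chi> i j. if i = j then (\<Sum>l\<in>UNIV. adjacency src tgt w $ i $ l) else 0)"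

definition laplacian :: "('m::finite \<Rightarrow> 'n::finite) \<Rightarrow> ('m \<Rightarrow> 'n) \<Rightarrow> ('m \<Rightarrow> real) \<Rightarrow> real^'n^'n" where
  "laplacian src tgt w = degree_matrix src tgt w - adjacency src tgt w"

text \<open>Moore--Penrose pseudoinverse, via its four defining equations.\<close>

definition is_pinv :: "real^'n::finite^'n \<Rightarrow> real^'n^'n \<Rightarrow> bool" where
  "is_pinv A X \<longleftrightarrow> A ** X ** A = A \<and> X ** A ** X = X \<and>
     transpose (A ** X) = A ** X \<and> transpose (X ** A) = X ** A"

definition pinv :: "real^'n::finite^'n \<Rightarrow> real^'n^'n" where
  "pinv A = (THE X. is_pinv A X)"

definition bvec :: "'n::finite \<Rightarrow> 'n \<Rightarrow> real^'n" where
  "bvec i j = axis i 1 - axis j 1"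

definition eff_res :: "real^'n::finite^'n \<Rightarrow> 'n \<Rightarrow> 'n \<Rightarrow> real" where
  "eff_res L i j = bvec i j \<bullet> (pinv L *v bvec i j)"

text \<open>Edge--vertex incidence matrix: row k is e_{src k} - e_{tgt k}.\<close>

definition incidence :: "('m::finite \<Rightarrow> 'n::finite) \<Rightarrow> ('m \<Rightarrow> 'n) \<Rightarrow> real^'n^'m" where
  "incidence src tgt = (\<chi> k. bvec (src k) (tgt k))"

definition esq :: "real^'m::finite \<Rightarrow> real^'m" where
  "esq x = (\<chi> k. (x $ k)^2)"

end

theory Submission
  imports Defs
begin

(* With b_e = bvec (src e) (tgt e), the Laplacian is L_w = sum_e w_e b_e b_e^T. For positive
   weights its kernel is the common kernel K of the b_e, which does not depend on w. Hence, with
   P the orthogonal projection onto K, L_w + P is invertible and L_w^+ = (L_w + P)^-1 - P.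
   Differentiating the inverse (P being constant) gives
   d/dw_e (x^T L_w^+ x) = -(b_e^T L_w^+ x)^2, so the gradient of R_lk with respect to the
   weights is -(B L^+ b_lk)^2 entrywise. The chain rule through w = p_theta(C) and through the
   squared loss then yields the formula. *)

lemma matrix_add_rdistrib:
  fixes A B :: "real^'n::finite^'m::finite" and C :: "real^'p::finite^'n"
  shows "(A + B) ** C = A ** C + B ** C"
  by (vector matrix_matrix_mult_def sum.distrib[symmetric] field_simps)

lemma matrix_diff_rdistrib:
  fixes A B :: "real^'n::finite^'m::finite" and C :: "real^'p::finite^'n"
  shows "(A - B) ** C = A ** C - B ** C"
  by (vector matrix_matrix_mult_def sum_subtractf[symmetric] field_simps)

lemma matrix_diff_ldistrib:
  fixes C :: "real^'n::finite^'m::finite" and A B :: "real^'p::finite^'n"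
  shows "C ** (A - B) = C ** A - C ** B"
  by (vector matrix_matrix_mult_def sum_subtractf[symmetric] field_simps)

lemma transpose_add:
  fixes A B :: "real^'n::finite^'m::finite"
  shows "transpose (A + B) = transpose A + transpose B"
  by (simp add: transpose_def vec_eq_iff)

lemma transpose_diff:
  fixes A B :: "real^'n::finite^'m::finite"
  shows "transpose (A - B) = transpose A - transpose B"
  by (simp add: transpose_def vec_eq_iff)

lemma matrix_inv_mult:
  fixes M :: "real^'n::finite^'n"
  assumes "invertible M"
  shows "M ** matrix_inv M = mat 1" "matrix_inv M ** M = mat 1"
proof -
  from assms obtain A where "M ** A = mat 1 \<and> A ** M = mat 1" unfolding invertible_def by blast
  then have "M ** matrix_inv M = mat 1 \<and> matrix_inv M ** M = mat 1"
    unfolding matrix_inv_def by (rule someI)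
  then show "M ** matrix_inv M = mat 1" "matrix_inv M ** M = mat 1" by auto
qed

lemma matrix_eq_0I:
  fixes A :: "real^'n::finite^'m::finite"
  shows "(\<And>x. A *v x = 0) \<Longrightarrow> A = 0"
  by (metis matrix_eq matrix_vector_mult_0)

lemma pinv_eqI:
  fixes A X :: "real^'n::finite^'n"
  assumes "is_pinv A X"
  shows "pinv A = X"
proof -
  have X: "A ** X ** A = A" "X ** A ** X = X"
    "transpose (A ** X) = A ** X" "transpose (X ** A) = X ** A"
    using assms by (auto simp: is_pinv_def)
  have "Y = X" if "is_pinv A Y" for Y
  proof -
    have Y: "A ** Y ** A = A" "Y ** A ** Y = Y"
      "transpose (A ** Y) = A ** Y" "transpose (Y ** A) = Y ** A"
      using that by (auto simp: is_pinv_def)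
    have "X = X ** transpose (A ** Y ** A ** X)"
      using X Y by (simp add: matrix_mul_assoc)
    also have "\<dots> = X ** (transpose (A ** X) ** transpose (A ** Y))"
      by (simp add: matrix_transpose_mul matrix_mul_assoc)
    also have "\<dots> = X ** A ** Y"
      using X Y by (simp add: matrix_mul_assoc)
    finally have X_eq: "X = X ** A ** Y" .
    have "Y ** A ** X ** A = Y ** A"
      by (metis X(1) matrix_mul_assoc)
    then have "Y = transpose (Y ** A ** X ** A) ** Y"
      using Y by simp
    also have "\<dots> = (transpose (X ** A) ** transpose (Y ** A)) ** Y"
      by (simp add: matrix_transpose_mul matrix_mul_assoc)
    also have "\<dots> = X ** A ** Y"
      by (simp only: X(4) Y(4)) (metis Y(2) matrix_mul_assoc)
    finally show "Y = X" using X_eq by simp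
  qed
  then show ?thesis
    unfolding pinv_def using assms by blast
qed

lemma pinv_eq_matrix_inv_add_diff:
  fixes A P :: "real^'n::finite^'n"
  assumes P_sym: "transpose P = P" and P_idem: "P ** P = P"
    and AP: "A ** P = 0" and PA: "P ** A = 0"
    and inv: "invertible (A + P)"
  shows "pinv A = matrix_inv (A + P) - P"
proof (rule pinv_eqI)
  define N where "N = matrix_inv (A + P)"
  note N = matrix_inv_mult[OF inv, folded N_def]
  have PN: "P ** N = P"
  proof -
    have "P ** (A + P) = P" by (simp add: matrix_add_ldistrib PA P_idem)
    then show ?thesis by (metis N(1) matrix_mul_assoc matrix_mul_rid)
  qed
  have NP: "N ** P = P"
  proof -
    have "(A + P) ** P = P" by (simp add: matrix_add_rdistrib AP P_idem)
    then show ?thesis by (metis N(2) matrix_mul_assoc matrix_mul_lid)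
  qed
  have AX: "A ** (N - P) = mat 1 - P"
    using N(1) by (simp add: matrix_diff_ldistrib matrix_add_rdistrib AP PN eq_diff_eq)
  have XA: "(N - P) ** A = mat 1 - P"
    using N(2) by (simp add: matrix_diff_rdistrib matrix_add_ldistrib PA NP eq_diff_eq)
  have sym: "transpose (mat 1 - P) = mat 1 - P"
    by (simp add: transpose_diff P_sym)
  show "is_pinv A (N - P)"
    unfolding is_pinv_def AX XA sym
    by (simp add: matrix_diff_rdistrib matrix_diff_ldistrib PA PN P_idem)
qed

lemma orthogonal_projection_matrix:
  fixes V :: "(real^'n::finite) set"
  assumes "subspace V"
  obtains P :: "real^'n^'n"
  where "transpose P = P" "\<And>x. P *v x \<in> V" "\<And>x. x \<in> V \<Longrightarrow> P *v x = x"
proof -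
  obtain B where B: "B \<subseteq> V" "pairwise orthogonal B" "\<And>x. x \<in> B \<Longrightarrow> norm x = 1"
    "independent B" "span B = V"
    using orthonormal_basis_subspace[OF assms] by metis
  define P :: "real^'n^'n" where "P = (\<chi> i j. \<Sum>u\<in>B. u$i * u$j)"
  have P_mult: "P *v x = (\<Sum>u\<in>B. (u \<bullet> x) *\<^sub>R u)" for x
    by (simp add: vec_eq_iff P_def matrix_vector_mult_def inner_vec_def sum_distrib_left
      sum_distrib_right sum_component mult_ac) (subst sum.swap; simp add: sum_distrib_left mult_ac)
  show thesis
  proof
    show "transpose P = P"
      by (simp add: P_def transpose_def vec_eq_iff mult_ac)
    show "P *v x \<in> V" for x
      unfolding P_mult using B(1) assms by (intro subspace_sum subspace_scale) auto
    show "P *v x = x" if "x \<in> V" for x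
      using orthonormal_basis_expand[OF B(2,3)] independent_imp_finite[OF B(4)] that B(5)
      by (simp add: P_mult inner_commute[of _ x])
  qed
qed

lemma has_derivative_vec_lambda:
  fixes f :: "'a::real_normed_vector \<Rightarrow> real^'n::finite"
  assumes "\<And>i. ((\<lambda>x. f x $ i) has_derivative (\<lambda>h. f' h $ i)) (at x0)"
  shows "(f has_derivative f') (at x0)"
proof (rule iffD2[OF has_derivative_componentwise_within], intro ballI)
  fix b :: "real^'n"
  assume "b \<in> Basis"
  then obtain i where "b = axis i 1"
    unfolding Basis_vec_def by auto
  then show "((\<lambda>x. f x \<bullet> b) has_derivative (\<lambda>x. f' x \<bullet> b)) (at x0)"
    using assms by (simp add: inner_axis)
qed

lemma differentiable_vec_lambda:
  fixes f :: "'a::real_normed_vector \<Rightarrow> real^'n::finite"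
  assumes "\<And>i. (\<lambda>x. f x $ i) differentiable (at x0)"
  shows "f differentiable (at x0)"
proof -
  obtain D where "\<And>i. ((\<lambda>x. f x $ i) has_derivative D i) (at x0)"
    using assms unfolding differentiable_def by metis
  then have "(f has_derivative (\<lambda>h. \<chi> i. D i h)) (at x0)"
    by (intro has_derivative_vec_lambda) simp
  then show ?thesis
    unfolding differentiable_def by blast
qed

lemma differentiable_prod:
  fixes f :: "'i \<Rightarrow> 'a::real_normed_vector \<Rightarrow> real"
  assumes "\<And>i. i \<in> I \<Longrightarrow> f i differentiable (at x0)"
  shows "(\<lambda>x. \<Prod>i\<in>I. f i x) differentiable (at x0)"
proof -
  obtain D where "\<And>i. i \<in> I \<Longrightarrow> (f i has_derivative D i) (at x0)"
    using assms unfolding differentiable_def by metis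
  then show ?thesis
    unfolding differentiable_def by (blast intro: has_derivative_prod)
qed

lemma differentiable_det:
  fixes A :: "'a::real_normed_vector \<Rightarrow> real^'n::finite^'n"
  assumes "\<And>i j. (\<lambda>x. A x $ i $ j) differentiable (at x0)"
  shows "(\<lambda>x. det (A x)) differentiable (at x0)"
  unfolding det_def
  by (intro differentiable_sum ballI differentiable_mult differentiable_const differentiable_prod
      assms finite_permutations) simp

lemma bounded_bilinear_matrix_vector_mult:
  "bounded_bilinear ((*v) :: real^'n::finite^'m::finite \<Rightarrow> real^'n \<Rightarrow> real^'m)"
  unfolding bilinear_conv_bounded_bilinear[symmetric] bilinear_def
  by (auto intro!: linearI simp: matrix_vector_mult_add_rdistrib matrix_vector_right_distrib
      matrix_scaleR_vector_ac scaleR_matrix_vector_assoc)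

lemma symmetric_matrix_inv:
  fixes M :: "real^'n::finite^'n"
  assumes "invertible M" "transpose M = M"
  shows "transpose (matrix_inv M) = matrix_inv M"
proof -
  note inv = matrix_inv_mult[OF assms(1)]
  have "transpose (matrix_inv M) ** M = mat 1"
    using arg_cong[OF inv(1), of transpose] assms(2) by (simp add: matrix_transpose_mul)
  have "transpose (matrix_inv M) = transpose (matrix_inv M) ** (M ** matrix_inv M)"
    using inv by simp
  also have "\<dots> = (transpose (matrix_inv M) ** M) ** matrix_inv M"
    by (rule matrix_mul_assoc)
  also have "\<dots> = matrix_inv M"
    using \<open>transpose (matrix_inv M) ** M = mat 1\<close> by simp
  finally show ?thesis .
qed

lemma differentiable_matrix_entry:
  fixes M :: "'a::real_normed_vector \<Rightarrow> real^'n::finite^'m::finite"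
  assumes "M differentiable (at x0)"
  shows "(\<lambda>x. M x $ i $ j) differentiable (at x0)"
proof -
  obtain D where "(M has_derivative D) (at x0)"
    using assms unfolding differentiable_def by blast
  then have "((\<lambda>x. M x $ i $ j) has_derivative (\<lambda>h. D h $ i $ j)) (at x0)"
    by (intro bounded_linear.has_derivative[OF bounded_linear_vec_nth])
  then show ?thesis
    unfolding differentiable_def by blast
qed

lemma eventually_invertible_at:
  fixes M :: "'a::real_normed_vector \<Rightarrow> real^'n::finite^'n"
  assumes M: "M differentiable (at x0)" and inv: "invertible (M x0)"
  shows "\<forall>\<^sub>F x in at x0. invertible (M x)"
proof -
  have "(\<lambda>x. det (M x)) differentiable (at x0)"
    by (intro differentiable_det differentiable_matrix_entry M)
  then have "((\<lambda>x. det (M x)) \<longlongrightarrow> det (M x0)) (at x0)"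
    using continuous_at differentiable_imp_continuous_within by blast
  then have "\<forall>\<^sub>F x in at x0. det (M x) \<noteq> 0"
    using inv invertible_det_nz tendsto_imp_eventually_ne by blast
  then show ?thesis
    by (simp add: invertible_det_nz)
qed

lemma differentiable_matrix_inv_mult:
  fixes M :: "'a::real_normed_vector \<Rightarrow> real^'n::finite^'n"
  assumes M: "M differentiable (at x0)" and inv: "invertible (M x0)"
  shows "(\<lambda>x. matrix_inv (M x) *v y) differentiable (at x0)"
proof -
  define cramer_sol where
    "cramer_sol x = (\<chi> k. det (\<chi> i j. if j = k then y$i else M x$i$j) / det (M x))" for x
  have cramer_eq: "matrix_inv (M x) *v y = cramer_sol x" if "invertible (M x)" for x
    using that cramer[of "M x" "matrix_inv (M x) *v y" y]
    by (simp add: invertible_det_nz cramer_sol_def matrix_vector_mul_assoc matrix_inv_mult)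
  have "(\<lambda>x. if j = k then y$i else M x$i$j) differentiable (at x0)" for i j k
    by (cases "j = k") (simp_all add: differentiable_matrix_entry M)
  then have "(\<lambda>x. cramer_sol x $ k) differentiable (at x0)" for k
    unfolding cramer_sol_def vec_lambda_beta using inv
    by (intro differentiable_divide differentiable_det)
      (auto simp: invertible_det_nz differentiable_matrix_entry[OF M])
  then have "cramer_sol differentiable (at x0)"
    by (rule differentiable_vec_lambda)
  then obtain D where "(cramer_sol has_derivative D) (at x0)"
    unfolding differentiable_def by blast
  moreover have "\<forall>\<^sub>F x in at x0. cramer_sol x = matrix_inv (M x) *v y"
    using eventually_invertible_at[OF M inv] by (rule eventually_mono) (simp add: cramer_eq)
  ultimately have "((\<lambda>x. matrix_inv (M x) *v y) has_derivative D) (at x0)"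
    by (rule has_derivative_transform_eventually) (simp_all add: cramer_eq inv)
  then show ?thesis
    unfolding differentiable_def by blast
qed

text \<open>The derivative is found by differentiating the identity \<open>M x *v (N x *v y) = y\<close>.\<close>

lemma has_derivative_matrix_inv_mult:
  fixes M :: "'a::real_normed_vector \<Rightarrow> real^'n::finite^'n"
  assumes M: "(M has_derivative M') (at x0)" and inv: "invertible (M x0)"
  shows "((\<lambda>x. matrix_inv (M x) *v y) has_derivative
          (\<lambda>h. - (matrix_inv (M x0) *v (M' h *v (matrix_inv (M x0) *v y))))) (at x0)"
proof -
  define N where "N x = matrix_inv (M x)" for x
  have M_diff: "M differentiable (at x0)"
    using M unfolding differentiable_def by blast
  obtain y' where y': "((\<lambda>x. N x *v y) has_derivative y') (at x0)"
    using differentiable_matrix_inv_mult[OF M_diff inv] unfolding N_def differentiable_def by blast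
  have "((\<lambda>x. M x *v (N x *v y)) has_derivative (\<lambda>h. M x0 *v y' h + M' h *v (N x0 *v y))) (at x0)"
    by (rule bounded_bilinear.FDERIV[OF bounded_bilinear_matrix_vector_mult M y'])
  moreover have "((\<lambda>x. M x *v (N x *v y)) has_derivative (\<lambda>h. 0)) (at x0)"
  proof (rule has_derivative_transform_eventually[OF has_derivative_const])
    show "\<forall>\<^sub>F x in at x0. y = M x *v (N x *v y)"
      using eventually_invertible_at[OF M_diff inv]
      by (rule eventually_mono) (simp add: N_def matrix_vector_mul_assoc matrix_inv_mult)
  qed (simp_all add: inv N_def matrix_vector_mul_assoc matrix_inv_mult)
  ultimately have "(\<lambda>h. M x0 *v y' h + M' h *v (N x0 *v y)) = (\<lambda>h. 0)"
    by (rule has_derivative_unique)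
  then have M_y': "M x0 *v y' h = - (M' h *v (N x0 *v y))" for h
    by (simp add: fun_eq_iff eq_neg_iff_add_eq_0)
  have "y' h = - (N x0 *v (M' h *v (N x0 *v y)))" for h
  proof -
    have "y' h = N x0 *v (M x0 *v y' h)"
      by (simp add: N_def inv matrix_inv_mult matrix_vector_mul_assoc)
    then show ?thesis
      by (simp only: M_y' vec.neg)
  qed
  then have "y' = (\<lambda>h. - (N x0 *v (M' h *v (N x0 *v y))))"
    by (rule ext)
  with y' show ?thesis
    unfolding N_def by simp
qed

definition weighted_outer_sum :: "('m::finite \<Rightarrow> real^'n::finite) \<Rightarrow> real^'m \<Rightarrow> real^'n^'n"
  where "weighted_outer_sum b w = (\<chi> i j. \<Sum>e\<in>UNIV. w$e * (b e $ i * b e $ j))"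

lemma weighted_outer_sum_mult_vec:
  "weighted_outer_sum b w *v x = (\<Sum>e\<in>UNIV. (w$e * (b e \<bullet> x)) *\<^sub>R b e)"
  by (simp add: vec_eq_iff weighted_outer_sum_def matrix_vector_mult_def inner_vec_def
      sum_distrib_left sum_distrib_right sum_component mult_ac)
    (subst sum.swap; simp add: sum_distrib_left mult_ac)

lemma inner_weighted_outer_sum:
  "x \<bullet> (weighted_outer_sum b w *v x) = (\<Sum>e\<in>UNIV. w$e * (b e \<bullet> x)^2)"
  by (simp add: weighted_outer_sum_mult_vec inner_sum_right power2_eq_square inner_commute mult_ac)

lemma transpose_weighted_outer_sum: "transpose (weighted_outer_sum b w) = weighted_outer_sum b w"
  by (simp add: weighted_outer_sum_def transpose_def vec_eq_iff mult_ac)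

lemma bounded_linear_weighted_outer_sum: "bounded_linear (weighted_outer_sum b)"
  unfolding linear_conv_bounded_linear[symmetric]
  by (rule linearI) (simp_all add: weighted_outer_sum_def vec_eq_iff sum.distrib
      sum_distrib_left algebra_simps)

lemma open_positive_orthant: "open {w::real^'m::finite. \<forall>e. 0 < w$e}"
proof -
  have "{w::real^'m. \<forall>e. 0 < w$e} = (\<Inter>e. {w. 0 < w$e})"
    by auto
  then show ?thesis
    by (simp add: open_INT open_Collect_less continuous_on_component continuous_on_const)
qed

locale kernel_projection =
  fixes b :: "'m::finite \<Rightarrow> real^'n::finite" and P :: "real^'n^'n"
  assumes symmetric: "transpose P = P"
    and range_orthogonal: "b e \<bullet> (P *v x) = 0"
    and fixes_kernel: "(\<And>e. b e \<bullet> x = 0) \<Longrightarrow> P *v x = x"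

lemma kernel_projection_exists: "\<exists>P. kernel_projection b P"
proof -
  have "subspace {x. \<forall>e. b e \<bullet> x = 0}"
    unfolding subspace_def by (auto simp: inner_add_right)
  then obtain P where "transpose P = P" "\<And>x. P *v x \<in> {x. \<forall>e. b e \<bullet> x = 0}"
    "\<And>x. x \<in> {x. \<forall>e. b e \<bullet> x = 0} \<Longrightarrow> P *v x = x"
    using orthogonal_projection_matrix by blast
  then have "kernel_projection b P"
    by unfold_locales auto
  then show ?thesis ..
qed

context kernel_projection
begin

lemma idempotent: "P ** P = P"
  by (subst matrix_eq) (simp add: matrix_vector_mul_assoc[symmetric] range_orthogonal fixes_kernel)

lemma weighted_outer_sum_mult_projection: "weighted_outer_sum b w ** P = 0"
  by (rule matrix_eq_0I)
    (simp add: matrix_vector_mul_assoc[symmetric] weighted_outer_sum_mult_vec range_orthogonal)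

lemma projection_mult_weighted_outer_sum: "P ** weighted_outer_sum b w = 0"
proof -
  have "P ** weighted_outer_sum b w = transpose (weighted_outer_sum b w ** P)"
    by (simp add: matrix_transpose_mul transpose_weighted_outer_sum symmetric)
  then show ?thesis
    by (simp add: weighted_outer_sum_mult_projection transpose_def vec_eq_iff)
qed

lemma invertible_weighted_outer_sum_add:
  assumes pos: "\<And>e. 0 < w$e"
  shows "invertible (weighted_outer_sum b w + P)"
proof -
  have "x = 0" if x: "(weighted_outer_sum b w + P) *v x = 0" for x
  proof -
    have "x \<bullet> (P *v x) = (P *v x) \<bullet> (P *v x)"
      by (metis dot_lmul_matrix idempotent matrix_vector_mul_assoc symmetric transpose_matrix_vector)
    then have "(\<Sum>e\<in>UNIV. w$e * (b e \<bullet> x)^2) + (P *v x) \<bullet> (P *v x) = 0"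
      using arg_cong[OF x, of "inner x"]
      by (simp add: matrix_vector_mult_add_rdistrib inner_add_right inner_weighted_outer_sum)
    moreover have nonneg: "0 \<le> w$e * (b e \<bullet> x)^2" for e
      using pos[of e] by simp
    moreover have "0 \<le> (\<Sum>e\<in>UNIV. w$e * (b e \<bullet> x)^2)"
      by (simp add: sum_nonneg nonneg)
    ultimately have "(\<Sum>e\<in>UNIV. w$e * (b e \<bullet> x)^2) = 0" "(P *v x) \<bullet> (P *v x) = 0"
      using inner_ge_zero[of "P *v x"] by linarith+
    then have "b e \<bullet> x = 0" for e
      using sum_nonneg_eq_0_iff[of UNIV "\<lambda>e. w$e * (b e \<bullet> x)^2"] nonneg pos[of e]
      by (auto simp: less_le)
    with \<open>(P *v x) \<bullet> (P *v x) = 0\<close> show "x = 0"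
      using fixes_kernel by auto
  qed
  then show ?thesis
    by (simp add: invertible_left_inverse matrix_left_invertible_ker)
qed

lemma pinv_weighted_outer_sum:
  assumes "\<And>e. 0 < w$e"
  shows "pinv (weighted_outer_sum b w) = matrix_inv (weighted_outer_sum b w + P) - P"
  using symmetric idempotent weighted_outer_sum_mult_projection projection_mult_weighted_outer_sum
    invertible_weighted_outer_sum_add[OF assms]
  by (rule pinv_eq_matrix_inv_add_diff)

lemma has_derivative_inner_pinv_weighted_outer_sum:
  assumes pos: "\<And>e. 0 < w0$e"
  shows "((\<lambda>w. x \<bullet> (pinv (weighted_outer_sum b w) *v x)) has_derivative
          (\<lambda>d. - (\<Sum>e\<in>UNIV. d$e * (b e \<bullet> (pinv (weighted_outer_sum b w0) *v x))^2))) (at w0)"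
proof -
  define N where "N w = matrix_inv (weighted_outer_sum b w + P)" for w
  define y where "y = N w0 *v x"
  have "((\<lambda>w. weighted_outer_sum b w + P) has_derivative weighted_outer_sum b) (at w0)"
    by (intro has_derivative_add_const bounded_linear_imp_has_derivative
        bounded_linear_weighted_outer_sum)
  then have "((\<lambda>w. N w *v x) has_derivative (\<lambda>d. - (N w0 *v (weighted_outer_sum b d *v y)))) (at w0)"
    unfolding N_def y_def using invertible_weighted_outer_sum_add[OF pos]
    by (rule has_derivative_matrix_inv_mult)
  then have "((\<lambda>w. x \<bullet> (N w *v x) - x \<bullet> (P *v x)) has_derivative
              (\<lambda>d. x \<bullet> - (N w0 *v (weighted_outer_sum b d *v y)) - 0)) (at w0)"
    by (intro has_derivative_diff has_derivative_const
        bounded_linear.has_derivative[OF bounded_linear_inner_right])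
  then have deriv: "((\<lambda>w. x \<bullet> (pinv (weighted_outer_sum b w) *v x)) has_derivative
              (\<lambda>d. x \<bullet> - (N w0 *v (weighted_outer_sum b d *v y)) - 0)) (at w0)"
    by (rule has_derivative_transform_within_open[OF _ open_positive_orthant])
      (use pos in \<open>auto simp: pinv_weighted_outer_sum N_def matrix_vector_mult_diff_rdistrib
        inner_diff_right\<close>)
  have N_sym: "transpose (N w0) = N w0"
    unfolding N_def using invertible_weighted_outer_sum_add[OF pos]
    by (rule symmetric_matrix_inv) (simp add: transpose_add transpose_weighted_outer_sum symmetric)
  have b_y: "b e \<bullet> y = b e \<bullet> (pinv (weighted_outer_sum b w0) *v x)" for e
    by (simp add: y_def N_def pinv_weighted_outer_sum[OF pos] matrix_vector_mult_diff_rdistrib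
        inner_diff_right range_orthogonal)
  have "x \<bullet> - (N w0 *v (weighted_outer_sum b d *v y)) = - (y \<bullet> (weighted_outer_sum b d *v y))" for d
    by (metis N_sym dot_lmul_matrix inner_minus_right transpose_matrix_vector y_def)
  with deriv show ?thesis
    by (simp add: inner_weighted_outer_sum b_y)
qed

end

lemma bvec_nth: "bvec i j $ k = (if k = i then 1 else 0) - (if k = j then 1 else 0)"
  by (simp add: bvec_def axis_def)

text \<open>Loops need not be excluded: they cancel in the Laplacian, and \<open>bvec i i = 0\<close>.\<close>

lemma laplacian_eq_weighted_outer_sum:
  "laplacian src tgt f = weighted_outer_sum (\<lambda>e. bvec (src e) (tgt e)) (\<chi> e. f e)"
proof -
  let ?W = "weighted_outer_sum (\<lambda>e. bvec (src e) (tgt e)) (\<chi> e. f e)"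
  have adj: "adjacency src tgt f $ i $ j =
      (\<Sum>k\<in>UNIV. if (src k = i \<and> tgt k = j) \<or> (src k = j \<and> tgt k = i) then f k else 0)" for i j
    by (simp add: adjacency_def sum.If_cases)
  have off_diag: "laplacian src tgt f $ i $ j = ?W $ i $ j"
    if "i \<noteq> j" for i j
    using that unfolding laplacian_def degree_matrix_def weighted_outer_sum_def
    by (auto simp: adj bvec_nth sum_negf[symmetric] intro!: sum.cong)
  have incident:
    "(\<Sum>l\<in>UNIV. if (src k = i \<and> tgt k = l) \<or> (src k = l \<and> tgt k = i) then f k else 0) =
      (if src k = i \<or> tgt k = i then f k else 0)" for i k
  proof (cases "src k = i")
    case True
    then have "((src k = i \<and> tgt k = l) \<or> (src k = l \<and> tgt k = i)) \<longleftrightarrow> tgt k = l" for l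
      by auto
    with True show ?thesis
      by simp
  next
    case False
    then show ?thesis
      by (simp add: eq_commute)
  qed
  have degree: "(\<Sum>l\<in>UNIV. adjacency src tgt f $ i $ l) =
      (\<Sum>k\<in>UNIV. if src k = i \<or> tgt k = i then f k else 0)" for i
    unfolding adj by (subst sum.swap) (simp add: incident)
  have diag: "laplacian src tgt f $ i $ i = ?W $ i $ i" for i
  proof -
    have "laplacian src tgt f $ i $ i =
        (\<Sum>l\<in>UNIV. adjacency src tgt f $ i $ l) - adjacency src tgt f $ i $ i"
      by (simp add: laplacian_def degree_matrix_def)
    also have "\<dots> = (\<Sum>k\<in>UNIV. (if src k = i \<or> tgt k = i then f k else 0) -
        (if src k = i \<and> tgt k = i then f k else 0))"
      by (simp only: degree) (simp add: adj sum_subtractf)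
    also have "\<dots> = ?W $ i $ i"
      unfolding weighted_outer_sum_def vec_lambda_beta bvec_nth
      by (intro sum.cong refl) auto
    finally show ?thesis .
  qed
  show ?thesis
    unfolding vec_eq_iff using diag off_diag by metis
qed

lemma has_derivative_jacobian:
  fixes f :: "real^'t::finite \<Rightarrow> real^'m::finite"
  assumes "\<And>e. (\<lambda>t. f t $ e) differentiable (at t0)"
  shows "(f has_derivative
          (*v) (\<chi> e j. frechet_derivative (\<lambda>t. f t $ e) (at t0) (axis j 1))) (at t0)"
proof -
  define D where "D h = (\<chi> e. frechet_derivative (\<lambda>t. f t $ e) (at t0) h)" for h
  have "(f has_derivative D) (at t0)"
    unfolding D_def using assms
    by (intro has_derivative_vec_lambda) (simp add: frechet_derivative_works)
  moreover have "(\<chi> e j. frechet_derivative (\<lambda>t. f t $ e) (at t0) (axis j 1)) = matrix D"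
    by (simp add: matrix_def D_def)
  ultimately show ?thesis
    using has_derivative_bounded_linear matrix_vector_mul(3) by metis
qed

lemma incidence_mult_vec_nth: "(incidence src tgt *v x) $ e = bvec (src e) (tgt e) \<bullet> x"
  by (simp add: incidence_def matrix_vector_mult_def inner_vec_def mult.commute)

lemma has_derivative_eff_res_laplacian:
  assumes pos: "\<And>e. 0 < w0$e"
  shows "((\<lambda>w. eff_res (laplacian src tgt (\<lambda>e. w$e)) l k) has_derivative
          (\<lambda>d. - (esq (incidence src tgt *v (pinv (laplacian src tgt (\<lambda>e. w0$e)) *v bvec l k)) \<bullet> d)))
         (at w0)"
proof -
  obtain P where "kernel_projection (\<lambda>e. bvec (src e) (tgt e)) P"
    using kernel_projection_exists by blast
  from kernel_projection.has_derivative_inner_pinv_weighted_outer_sum[OF this pos, of "bvec l k"]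
  show ?thesis
    by (simp add: eff_res_def laplacian_eq_weighted_outer_sum esq_def incidence_mult_vec_nth
        inner_vec_def mult.commute)
qed

theorem proposition1:
  fixes src tgt :: "'m::finite \<Rightarrow> 'n::finite"
    and C :: "'m \<Rightarrow> real^'q::finite"
    and p :: "real^'t::finite \<Rightarrow> real^'q \<Rightarrow> real"
    and S :: "'n set"
    and F :: "'n \<Rightarrow> 'n \<Rightarrow> real"
    and th0 :: "real^'t"
  assumes no_loops: "\<forall>k. src k \<noteq> tgt k"
    and simple: "\<forall>k k'. {src k, tgt k} = {src k', tgt k'} \<longrightarrow> k = k'"
    and pos: "\<forall>t c. p t c > 0"
    and diff: "\<forall>t c. (\<lambda>u. p u c) differentiable (at t)"
    and Fdiag: "\<forall>l\<in>S. F l l = 0"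
  shows "((\<lambda>t. \<Sum>l\<in>S. \<Sum>k\<in>S. (eff_res (laplacian src tgt (\<lambda>e. p t (C e))) l k - F l k)^2)
          has_derivative
          (\<lambda>h. (\<Sum>l\<in>S. \<Sum>k\<in>S.
              (F l k - eff_res (laplacian src tgt (\<lambda>e. p th0 (C e))) l k) *\<^sub>R
              (2 *\<^sub>R (transpose (\<chi> e hh. frechet_derivative (\<lambda>t. p t (C e)) (at th0) (axis hh 1))
                 *v esq (incidence src tgt *v (pinv (laplacian src tgt (\<lambda>e. p th0 (C e))) *v bvec l k)))))
             \<bullet> h)) (at th0)"
proof -
  define w where "w t = (\<chi> e. p t (C e))" for t
  define J where "J = (\<chi> e hh. frechet_derivative (\<lambda>t. p t (C e)) (at th0) (axis hh 1))"
  define L0 where "L0 = laplacian src tgt (\<lambda>e. p th0 (C e))"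
  define v where "v l k = esq (incidence src tgt *v (pinv L0 *v bvec l k))" for l k
  have w_deriv: "(w has_derivative (*v) J) (at th0)"
    using has_derivative_jacobian[of w th0] diff by (simp add: w_def J_def)
  have "((\<lambda>w. eff_res (laplacian src tgt (\<lambda>e. w$e)) l k) has_derivative (\<lambda>d. - (v l k \<bullet> d)))
      (at (w th0))" for l k
    using has_derivative_eff_res_laplacian[of "w th0"] pos by (simp add: w_def v_def L0_def)
  from has_derivative_compose[OF w_deriv this]
  have "((\<lambda>t. eff_res (laplacian src tgt (\<lambda>e. w t $ e)) l k) has_derivative
      (\<lambda>h. - (v l k \<bullet> (J *v h)))) (at th0)" for l k .
  then have "((\<lambda>t. eff_res (laplacian src tgt (\<lambda>e. p t (C e))) l k) has_derivative
      (\<lambda>h. - (v l k \<bullet> (J *v h)))) (at th0)" for l k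
    by (simp add: w_def)
  then have "((\<lambda>t. \<Sum>l\<in>S. \<Sum>k\<in>S. (eff_res (laplacian src tgt (\<lambda>e. p t (C e))) l k - F l k)^2)
      has_derivative (\<lambda>h. \<Sum>l\<in>S. \<Sum>k\<in>S. of_nat 2 * (- (v l k \<bullet> (J *v h)) - 0) *
        (eff_res L0 l k - F l k)^(2 - 1))) (at th0)"
    unfolding L0_def
    by (intro has_derivative_sum has_derivative_power has_derivative_diff has_derivative_const)
  moreover have "v l k \<bullet> (J *v h) = (transpose J *v v l k) \<bullet> h" for l k h
    by (simp add: transpose_matrix_vector dot_lmul_matrix)
  ultimately show ?thesis
    by (simp add: J_def[symmetric] L0_def[symmetric] v_def[symmetric] inner_sum_left algebra_simps)
qed

end
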